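(* For $|q|<1$, $$\sum_{n=1}^{\infty} R_5(n)\, q^n = \frac{q^{15}\, N(q)}{(1-q)^2(1-q^3)(1-q^4)(1-q^5)},$$ where $$\begin{aligned}N(q) ={}& 1+4q+6q^2+8q^3+8q^4+4q^5+4q^6-5q^7-5q^8-10q^9-7q^{10}-5q^{11}\\ &+4q^{13}+6q^{14}+7q^{15}+2q^{17}-4q^{18}-q^{19}-q^{20}-q^{21}+q^{22}-q^{23}+q^{24},\end{aligned}$$ and $R_5(n)$ is the number of partitions of $n$ with max-rook number $5$.
   Context: A partition $\pi$ of a positive integer $n$ is a non-increasing sequence of positive integers $(\lambda_1,\dots,\lambda_r)$ with sum $n$; $\mathscr{P}(n)$ is the set of all partitions of $n$. The Ferrers board $B_\pi$ of $\pi=(\lambda_1,\dots,\lambda_r)$ is the left-justified array of unit squares with $r$ rows whose $i$-th row from the top has $\lambda_i$ squares. Rooks placed on squares of the board are non-intersecting if no two of them lie in the same row or the same column. The max-rook number $R(\pi)$ is the maximal number of non-intersecting rooks that can be placed in $B_\pi$. For positive integers $n,k$, $R_k(n):=\#\{\pi\in\mathscr{P}(n) : R(\pi)=k\}$. *)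

theory Defs
  imports Complex_Main
begin

definition partitions :: "nat \<Rightarrow> nat list set" where
  "partitions n = {\<pi>. sorted_wrt (\<ge>) \<pi> \<and> (\<forall>x\<in>set \<pi>. 0 < x) \<and> sum_list \<pi> = n}"

text \<open>A square is a pair (row, column); rows are counted from the top and columns from the
  left, both starting with 0.\<close>

definition ferrers_board :: "nat list \<Rightarrow> (nat \<times> nat) set" where
  "ferrers_board \<pi> = {(i, j). i < length \<pi> \<and> j < \<pi> ! i}"

text \<open>A placement of rooks is represented by the set of squares they occupy.\<close>

definition non_intersecting :: "(nat \<times> nat) set \<Rightarrow> bool" where
  "non_intersecting S \<longleftrightarrow>
     (\<forall>s\<in>S. \<forall>t\<in>S. s \<noteq> t \<longrightarrow> fst s \<noteq> fst t \<and> snd s \<noteq> snd t)"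

definition max_rook :: "nat list \<Rightarrow> nat" where
  "max_rook \<pi> = Max {card S | S. S \<subseteq> ferrers_board \<pi> \<and> non_intersecting S}"

definition R :: "nat \<Rightarrow> nat \<Rightarrow> nat" where
  "R k n = card {\<pi> \<in> partitions n. max_rook \<pi> = k}"

text \<open>The sets under \<^const>\<open>Max\<close> and \<^const>\<open>card\<close> above are finite, and the former is nonempty,
  so neither operator takes a default value.\<close>

lemma finite_ferrers_board: "finite (ferrers_board \<pi>)"
proof -
  have "ferrers_board \<pi> = Sigma {..<length \<pi>} (\<lambda>i. {..<\<pi> ! i})"
    by (auto simp: ferrers_board_def)
  then show ?thesis by simp
qed

lemma finite_rook_counts:
  "finite {card S | S. S \<subseteq> ferrers_board \<pi> \<and> non_intersecting S}"
  using finite_ferrers_board[of \<pi>] by simp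

lemma zero_in_rook_counts:
  "0 \<in> {card S | S. S \<subseteq> ferrers_board \<pi> \<and> non_intersecting S}"
  by (auto simp: non_intersecting_def intro!: exI[of _ "{}"])

lemma finite_partitions: "finite (partitions n)"
proof (rule finite_subset)
  show "partitions n \<subseteq> {xs. set xs \<subseteq> {..n} \<and> length xs \<le> n}"
  proof
    fix \<pi> assume "\<pi> \<in> partitions n"
    then have pos: "\<forall>x\<in>set \<pi>. 0 < x" and sum: "sum_list \<pi> = n"
      by (auto simp: partitions_def)
    have "length \<pi> \<le> sum_list \<pi>" using pos by (induction \<pi>) auto
    then show "\<pi> \<in> {xs. set xs \<subseteq> {..n} \<and> length xs \<le> n}"
      using sum member_le_sum_list by auto
  qed
qed (rule finite_lists_length_le, simp)

end

theory Submission
  imports Defs "HOL-Analysis.Elementary_Metric_Spaces" "HOL-Analysis.Infinite_Sum"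
begin

text \<open>A partition \<open>\<pi> = (\<lambda>\<^sub>0 \<ge> \<lambda>\<^sub>1 \<ge> \<dots>)\<close> (rows numbered from \<open>0\<close>, \<open>\<lambda>\<^sub>j = 0\<close> beyond the
last row) admits \<open>k\<close> non-intersecting rooks exactly when its board contains the staircase
\<open>(k, k - 1, \<dots>, 1)\<close>: rooks on the antidiagonal of the staircase give one direction, and if
\<open>\<lambda>\<^sub>i \<le> k - 1 - i\<close> for some \<open>i < k\<close>, then the board is covered by \<open>i\<close> rows and \<open>k - 1 - i\<close> columns, which
gives the other (\<open>le_max_rook_iff\<close>).

Hence the max-rook number is \<open>k\<close> iff \<open>\<pi>\<close> contains the staircase of size \<open>k\<close> and some \<open>i \<le> k\<close>
satisfies \<open>\<lambda>\<^sub>i + i = k\<close>. Cut \<open>\<pi>\<close> above the first such row \<open>i\<close>. Each of the \<open>i\<close> rows above the cut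
contains at least \<open>k + 1 - i\<close> squares; removing a rectangle of \<open>i\<close> rows and \<open>k + 1 - i\<close> columns leaves
at most \<open>i\<close> rows that still contain a staircase of size \<open>i\<close>. The rows below the cut have at most \<open>k - i\<close>
squares each and contain a staircase of size \<open>k - i\<close>. This is a bijection (\<open>glue_stairs\<close>,
\<open>cut_stairs\<close>), so that
\[ \sum_{R(\pi) = k} q^{|\pi|} = \sum_{i=0}^{k} q^{i(k+1-i)} S_i(q) S_{k-i}(q), \]
where \<open>S\<^sub>m\<close> is the generating function of the partitions with at most \<open>m\<close> rows, or equivalently at
most \<open>m\<close> columns, that contain a staircase of size \<open>m\<close> (\<open>max_rook_gf\<close>).

More generally let \<open>F m k\<close> be the generating function with \<open>m\<close> rows (or columns) and a staircase
of size \<open>k \<le> m\<close>. Distinguishing whether the last row is empty, or whether the first row has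
length \<open>m\<close>, one obtains \<open>F m k = F (m - 1) k + q ^ m * F m (k - 1)\<close> for \<open>m \<ge> 1\<close> and
\<open>k \<le> m\<close>, where \<open>k - 1\<close> is truncated at \<open>0\<close>, and \<open>F m k = 0\<close> if \<open>m < k\<close> (\<open>stair_gf_has_sum\<close>). This recursion determines \<open>S\<^sub>0, \<dots>, S\<^sub>5\<close> as rational
functions, and a polynomial identity remains.\<close>

section \<open>Rook numbers and staircases\<close>

text \<open>The board of \<open>\<pi>\<close> contains the staircase with rows \<open>k, k - 1, \<dots>, 1\<close>. The list may have
trailing zeros.\<close>

definition staircase :: "nat \<Rightarrow> nat list \<Rightarrow> bool" where
  "staircase k \<pi> \<longleftrightarrow> (\<forall>j<k. j < length \<pi> \<and> k \<le> \<pi> ! j + j)"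

lemma staircase_length: "staircase k \<pi> \<Longrightarrow> k \<le> length \<pi>"
  unfolding staircase_def by (meson not_le_imp_less less_irrefl)

lemma nonincreasing_nth:
  fixes \<pi> :: "nat list"
  assumes "sorted_wrt (\<ge>) \<pi>" "i \<le> j" "j < length \<pi>"
  shows "\<pi> ! j \<le> \<pi> ! i"
  using assms sorted_wrt_iff_nth_less[of "(\<ge>)" \<pi>] by (cases "i = j") auto

text \<open>If row \<open>i \<le> k\<close> has at most \<open>k - i\<close> squares, then the first \<open>i\<close> rows and the first \<open>k - i\<close> columns
cover the board, and each of these \<open>k\<close> lines contains at most one rook.\<close>

lemma rook_placement_card_le:
  assumes sorted: "sorted_wrt (\<ge>) \<pi>" and "i \<le> k"
    and corner: "\<not> (i < length \<pi> \<and> Suc k \<le> \<pi> ! i + i)"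
    and S: "S \<subseteq> ferrers_board \<pi>" "non_intersecting S"
  shows "card S \<le> k"
proof -
  define S1 where "S1 = {s \<in> S. fst s < i}"
  define S2 where "S2 = {s \<in> S. \<not> fst s < i}"
  have fin: "finite S"
    using S(1) finite_ferrers_board finite_subset by blast
  have inj: "inj_on fst S" "inj_on snd S"
    using S(2) unfolding non_intersecting_def inj_on_def by blast+
  have "snd s < k - i" if "s \<in> S2" for s
  proof -
    obtain a b where s: "s = (a, b)" by fastforce
    have ab: "i \<le> a" "a < length \<pi>" "b < \<pi> ! a"
      using that S(1) by (auto simp: S2_def s ferrers_board_def)
    have "\<pi> ! a \<le> \<pi> ! i"
      using nonincreasing_nth[OF sorted] ab by blast
    then show ?thesis using ab corner by (simp add: s)
  qed
  then have "snd ` S2 \<subseteq> {..<k - i}" by auto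
  moreover have "fst ` S1 \<subseteq> {..<i}" by (auto simp: S1_def)
  moreover have "card (snd ` S2) = card S2" "card (fst ` S1) = card S1"
    using inj by (auto intro!: card_image simp: S1_def S2_def inj_on_def)
  ultimately have "card S1 \<le> i" "card S2 \<le> k - i"
    by (metis card_lessThan card_mono finite_lessThan)+
  moreover have "card S = card S1 + card S2"
    unfolding S1_def S2_def using fin by (subst card_Un_disjoint[symmetric]) (auto intro: arg_cong[where f = card])
  ultimately show ?thesis using \<open>i \<le> k\<close> by linarith
qed

lemma le_max_rook_iff:
  assumes "sorted_wrt (\<ge>) \<pi>"
  shows "k \<le> max_rook \<pi> \<longleftrightarrow> staircase k \<pi>"
proof
  assume "staircase k \<pi>"
  \<comment> \<open>Rooks on the last squares of the rows of the staircase.\<close>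
  define S where "S = (\<lambda>j. (j, k - 1 - j)) ` {..<k}"
  have "S \<subseteq> ferrers_board \<pi>"
    using \<open>staircase k \<pi>\<close> by (fastforce simp: S_def staircase_def ferrers_board_def)
  moreover have "non_intersecting S" by (auto simp: S_def non_intersecting_def)
  moreover have "card S = k" by (auto simp: S_def card_image inj_on_def)
  ultimately have "k \<in> {card S | S. S \<subseteq> ferrers_board \<pi> \<and> non_intersecting S}" by blast
  then show "k \<le> max_rook \<pi>"
    unfolding max_rook_def using finite_rook_counts by (rule Max_ge[rotated])
next
  assume le: "k \<le> max_rook \<pi>"
  have "max_rook \<pi> \<in> {card S | S. S \<subseteq> ferrers_board \<pi> \<and> non_intersecting S}"
    unfolding max_rook_def
    by (rule Max_in[OF finite_rook_counts]) (use zero_in_rook_counts[of \<pi>] in blast)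
  then obtain S where S: "S \<subseteq> ferrers_board \<pi>" "non_intersecting S" "max_rook \<pi> = card S"
    by blast
  show "staircase k \<pi>"
  proof (rule ccontr)
    assume "\<not> staircase k \<pi>"
    then obtain i where i: "i < k" "\<not> (i < length \<pi> \<and> k \<le> \<pi> ! i + i)"
      by (auto simp: staircase_def)
    then have "card S \<le> k - 1"
      using S assms by (intro rook_placement_card_le[of \<pi> i]) auto
    then show False using S le i by linarith
  qed
qed

lemma max_rook_eq_iff:
  assumes "sorted_wrt (\<ge>) \<pi>"
  shows "max_rook \<pi> = k \<longleftrightarrow> staircase k \<pi> \<and> \<not> staircase (Suc k) \<pi>"
  unfolding le_max_rook_iff[OF assms, symmetric] by auto

section \<open>Cutting a partition at its first critical row\<close>

text \<open>Partitions with at most \<open>m\<close> rows that contain a staircase of size \<open>k\<close>, padded with zeros to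
length exactly \<open>m\<close>.\<close>

definition short_stairs :: "nat \<Rightarrow> nat \<Rightarrow> nat list set" where
  "short_stairs m k = {\<mu>. sorted_wrt (\<ge>) \<mu> \<and> length \<mu> = m \<and> staircase k \<mu>}"

text \<open>Partitions with at most \<open>m\<close> columns, without zero rows, that contain a staircase of
size \<open>k\<close>.\<close>

definition narrow_stairs :: "nat \<Rightarrow> nat \<Rightarrow> nat list set" where
  "narrow_stairs m k =
     {\<nu>. sorted_wrt (\<ge>) \<nu> \<and> (\<forall>x\<in>set \<nu>. 0 < x \<and> x \<le> m) \<and> staircase k \<nu>}"

text \<open>The first row \<open>i\<close> that is missing or has fewer than \<open>k + 1 - i\<close> squares, i.e. in which the
staircase of size \<open>k + 1\<close> sticks out of the board. If the board contains this staircase, the value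
is the number of rows.\<close>

definition corner :: "nat \<Rightarrow> nat list \<Rightarrow> nat" where
  "corner k \<pi> = (LEAST i. \<not> (i < length \<pi> \<and> Suc k \<le> \<pi> ! i + i))"

lemma corner_spec: "\<not> (corner k \<pi> < length \<pi> \<and> Suc k \<le> \<pi> ! corner k \<pi> + corner k \<pi>)"
  unfolding corner_def by (rule LeastI[of _ "length \<pi>"]) simp

lemma before_corner: "j < corner k \<pi> \<Longrightarrow> j < length \<pi> \<and> Suc k \<le> \<pi> ! j + j"
  unfolding corner_def by (blast dest: not_less_Least)

lemma corner_eqI:
  assumes "\<not> (i < length \<pi> \<and> Suc k \<le> \<pi> ! i + i)"
    and "\<And>j. j < i \<Longrightarrow> j < length \<pi> \<and> Suc k \<le> \<pi> ! j + j"
  shows "corner k \<pi> = i"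
  by (meson assms before_corner corner_spec linorder_neqE_nat)

lemma corner_le: "\<not> staircase (Suc k) \<pi> \<Longrightarrow> corner k \<pi> \<le> k"
  using before_corner[of _ k \<pi>] unfolding staircase_def by (meson less_Suc_eq_le less_le_trans not_le)

text \<open>Gluing, and then cutting, are inverse to each other: \<open>\<mu>\<close> is moved to the right of a rectangle of
\<open>i\<close> rows and \<open>k + 1 - i\<close> columns, and \<open>\<nu>\<close> is placed below it. The position of the cut is recovered as
the corner, so different \<open>i\<close> yield different partitions.\<close>

lemma glue_stairs:
  assumes ik: "i \<le> k" and \<mu>: "\<mu> \<in> short_stairs i i" and \<nu>: "\<nu> \<in> narrow_stairs (k - i) (k - i)"
  defines "\<pi> \<equiv> map ((+) (Suc k - i)) \<mu> @ \<nu>"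
  shows "sorted_wrt (\<ge>) \<pi>" "\<forall>x\<in>set \<pi>. 0 < x" "staircase k \<pi>" "\<not> staircase (Suc k) \<pi>"
    and "corner k \<pi> = i"
proof -
  have len: "length \<mu> = i" and m: "sorted_wrt (\<ge>) \<mu>" "staircase i \<mu>"
    using \<mu> by (auto simp: short_stairs_def)
  have n: "sorted_wrt (\<ge>) \<nu>" "\<forall>x\<in>set \<nu>. 0 < x \<and> x \<le> k - i" "staircase (k - i) \<nu>"
    using \<nu> by (auto simp: narrow_stairs_def)
  have upper: "j < length \<pi> \<and> Suc k \<le> \<pi> ! j + j" if "j < i" for j
    using that m(2) len ik by (fastforce simp: \<pi>_def nth_append staircase_def)
  have lower: "\<not> (i < length \<pi> \<and> Suc k \<le> \<pi> ! i + i)"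
  proof (cases "\<nu> = []")
    case False
    then have "\<nu> ! 0 \<le> k - i" using n(2) by simp
    then have "\<nu> ! 0 + i \<le> k" using ik by linarith
    then show ?thesis using len by (simp add: \<pi>_def nth_append)
  qed (simp add: \<pi>_def len)
  show "sorted_wrt (\<ge>) \<pi>"
    using m(1) n(1,2) by (fastforce simp: \<pi>_def sorted_wrt_append sorted_wrt_map)
  show "\<forall>x\<in>set \<pi>. 0 < x"
    using n(2) ik by (auto simp: \<pi>_def)
  show "corner k \<pi> = i" using upper lower by (intro corner_eqI) auto
  show "staircase k \<pi>"
    unfolding staircase_def
  proof (intro allI impI)
    fix j assume "j < k"
    show "j < length \<pi> \<and> k \<le> \<pi> ! j + j"
    proof (cases "j < i")
      case True
      then show ?thesis using upper[of j] by simp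
    next
      case False
      then have "j - i < k - i" using \<open>j < k\<close> by simp
      then have "j - i < length \<nu> \<and> k - i \<le> \<nu> ! (j - i) + (j - i)"
        using n(3) unfolding staircase_def by blast
      then show ?thesis using False len ik by (simp add: \<pi>_def nth_append) linarith
    qed
  qed
  show "\<not> staircase (Suc k) \<pi>"
    using lower ik unfolding staircase_def by (meson le_imp_less_Suc)
qed

lemma cut_stairs:
  assumes sorted: "sorted_wrt (\<ge>) \<pi>" and pos: "\<forall>x\<in>set \<pi>. 0 < x"
    and st: "staircase k \<pi>" "\<not> staircase (Suc k) \<pi>"
  defines "i \<equiv> corner k \<pi>"
  shows "map (\<lambda>x. x - (Suc k - i)) (take i \<pi>) \<in> short_stairs i i"
    and "drop i \<pi> \<in> narrow_stairs (k - i) (k - i)"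
    and "map ((+) (Suc k - i)) (map (\<lambda>x. x - (Suc k - i)) (take i \<pi>)) = take i \<pi>"
proof -
  have ik: "i \<le> k" unfolding i_def using st by (intro corner_le)
  have len: "i \<le> length \<pi>" using ik staircase_length[OF st(1)] by simp
  have upper: "Suc k \<le> \<pi> ! j + j" if "j < i" for j
    using before_corner that unfolding i_def by blast
  have lower: "\<not> (i < length \<pi> \<and> Suc k \<le> \<pi> ! i + i)"
    unfolding i_def by (rule corner_spec)
  have sorted': "sorted_wrt (\<ge>) (take i \<pi>)" "sorted_wrt (\<ge>) (drop i \<pi>)"
    using sorted append_take_drop_id[of i \<pi>] by (metis sorted_wrt_append)+
  have "sorted_wrt (\<ge>) (map (\<lambda>x. x - (Suc k - i)) (take i \<pi>))"
    unfolding sorted_wrt_map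
    by (rule sorted_wrt_mono_rel[OF _ sorted'(1)]) (simp add: diff_le_mono)
  moreover have "staircase i (map (\<lambda>x. x - (Suc k - i)) (take i \<pi>))"
    using upper ik len by (fastforce simp: staircase_def)
  ultimately show "map (\<lambda>x. x - (Suc k - i)) (take i \<pi>) \<in> short_stairs i i"
    using len by (simp add: short_stairs_def)
  have "x \<le> k - i" if x: "x \<in> set (drop i \<pi>)" for x
  proof -
    obtain j where "j < length (drop i \<pi>)" "drop i \<pi> ! j = x"
      using x unfolding in_set_conv_nth by blast
    then have j: "j < length \<pi> - i" "x = \<pi> ! (i + j)" using len by auto
    then have "x \<le> \<pi> ! i" by (auto intro!: nonincreasing_nth[OF sorted])
    then show ?thesis using lower j by auto
  qed
  moreover have "staircase (k - i) (drop i \<pi>)"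
    unfolding staircase_def
  proof (intro allI impI)
    fix j assume "j < k - i"
    then have "i + j < length \<pi> \<and> k \<le> \<pi> ! (i + j) + (i + j)"
      using st(1) unfolding staircase_def by auto
    then show "j < length (drop i \<pi>) \<and> k - i \<le> drop i \<pi> ! j + j"
      by auto
  qed
  ultimately show "drop i \<pi> \<in> narrow_stairs (k - i) (k - i)"
    using sorted'(2) pos by (auto simp: narrow_stairs_def dest: in_set_dropD)
  have "Suc k - i \<le> x" if x: "x \<in> set (take i \<pi>)" for x
  proof -
    obtain j where j: "j < i" "x = \<pi> ! j"
      using x by (auto simp: in_set_conv_nth)
    then show ?thesis using upper[of j] by simp
  qed
  then show "map ((+) (Suc k - i)) (map (\<lambda>x. x - (Suc k - i)) (take i \<pi>)) = take i \<pi>"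
    by (auto intro!: map_idI)
qed

section \<open>Sums over sets of lists\<close>

lemma has_sum_product_complex:
  fixes f :: "'a \<Rightarrow> complex" and g :: "'b \<Rightarrow> complex"
  assumes f: "(f has_sum s) A" and g: "(g has_sum t) B"
  shows "((\<lambda>(x, y). f x * g y) has_sum (s * t)) (A \<times> B)"
proof (rule has_sum_SigmaI)
  show "((\<lambda>y. case (x, y) of (x, y) \<Rightarrow> f x * g y) has_sum (f x * t)) B" for x
    using has_sum_cmult_right[OF g, of "f x"] by simp
  show "((\<lambda>x. f x * t) has_sum (s * t)) A"
    by (rule has_sum_cmult_left[OF f])
  have "f abs_summable_on A" "g abs_summable_on B"
    using f[THEN has_sum_imp_summable] g[THEN has_sum_imp_summable]
    unfolding summable_on_iff_abs_summable_on_complex by blast+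
  then have "(\<lambda>(x, y). f x * g y) abs_summable_on A \<times> B"
    by (subst abs_summable_on_Sigma_iff)
      (auto simp: norm_mult infsum_cmult_right' abs_mult infsum_nonneg intro: summable_on_cmult_left summable_on_cmult_right)
  then show "(\<lambda>(x, y). f x * g y) summable_on A \<times> B"
    by (simp add: summable_on_iff_abs_summable_on_complex)
qed

text \<open>If \<open>A\<close> is the disjoint union of \<open>B\<close> and a copy of \<open>A\<close> whose weights are increased by \<open>d > 0\<close>, then
\<open>G\<^sub>A = G\<^sub>B + q ^ d * G\<^sub>A\<close>. Summability over \<open>A\<close> has to be shown first: the bound \<open>b / (1 - \<bar>q\<bar> ^ d)\<close> for finite
partial sums follows by induction on the largest weight that occurs, where \<open>b\<close> bounds
those over \<open>B\<close>; passing from \<open>g x\<close> back to \<open>x\<close> decreases the weight.\<close>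

lemma has_sum_self_similar:
  fixes q :: complex and A :: "nat list set"
  assumes q: "norm q < 1" and d: "0 < d"
    and A: "A = B \<union> g ` A" and disj: "B \<inter> g ` A = {}" and inj: "inj_on g A"
    and wt: "\<And>x. x \<in> A \<Longrightarrow> sum_list (g x) = d + sum_list x"
    and B: "((\<lambda>x. q ^ sum_list x) has_sum s) B"
  shows "((\<lambda>x. q ^ sum_list x) has_sum (s / (1 - q ^ d))) A"
proof -
  define w where "w = (\<lambda>x :: nat list. q ^ sum_list x)"
  define r where "r = norm q ^ d"
  have r: "0 \<le> r" "r < 1"
    using q d by (auto simp: r_def power_less_one_iff)
  have "w abs_summable_on B"
    using has_sum_imp_summable[OF B] unfolding summable_on_iff_abs_summable_on_complex w_def .
  then have "bdd_above (sum (\<lambda>x. norm (w x)) ` {F. F \<subseteq> B \<and> finite F})"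
    by (simp add: abs_summable_iff_bdd_above)
  then obtain b where b: "\<And>F. F \<subseteq> B \<Longrightarrow> finite F \<Longrightarrow> (\<Sum>x\<in>F. norm (w x)) \<le> b"
    unfolding bdd_above_def by auto
  have b0: "0 \<le> b" using b[of "{}"] by simp
  have bound: "(\<Sum>x\<in>F. norm (w x)) \<le> b / (1 - r)"
    if "F \<subseteq> A" "finite F" "\<forall>x\<in>F. sum_list x < n" for F n
    using that
  proof (induction n arbitrary: F)
    case 0
    then have "F = {}" by auto
    then show ?case using b0 r by simp
  next
    case (Suc n)
    define G where "G = {x \<in> A. g x \<in> F - B}"
    have GF: "g ` G = F - B"
      using Suc.prems(1) A by (auto simp: G_def)
    have injG: "inj_on g G" using inj by (auto simp: G_def inj_on_def)
    have "finite G" using GF Suc.prems(2) injG by (metis finite_Diff finite_imageD)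
    moreover have "\<forall>x\<in>G. sum_list x < n"
      using Suc.prems(3) wt d by (fastforce simp: G_def)
    ultimately have IH: "(\<Sum>x\<in>G. norm (w x)) \<le> b / (1 - r)"
      by (intro Suc.IH) (auto simp: G_def)
    have "(\<Sum>x\<in>F - B. norm (w x)) = (\<Sum>x\<in>G. norm (w (g x)))"
      unfolding GF[symmetric] by (rule sum.reindex[OF injG, unfolded o_def])
    also have "\<dots> = r * (\<Sum>x\<in>G. norm (w x))"
      unfolding sum_distrib_left
      by (rule sum.cong) (auto simp: G_def w_def wt r_def power_add norm_mult norm_power)
    also have "\<dots> \<le> r * (b / (1 - r))"
      using IH r by (intro mult_left_mono) auto
    finally have "(\<Sum>x\<in>F - B. norm (w x)) \<le> r * (b / (1 - r))" .
    moreover have "(\<Sum>x\<in>F \<inter> B. norm (w x)) \<le> b"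
      using Suc.prems by (intro b) auto
    moreover have "(\<Sum>x\<in>F. norm (w x)) = (\<Sum>x\<in>F \<inter> B. norm (w x)) + (\<Sum>x\<in>F - B. norm (w x))"
      using Suc.prems by (intro sum.Int_Diff)
    moreover have "b + r * (b / (1 - r)) = b / (1 - r)"
      using r by (simp add: field_simps)
    ultimately show ?case by linarith
  qed
  have "w abs_summable_on A"
    unfolding abs_summable_iff_bdd_above
  proof (rule bdd_aboveI2)
    fix F assume F: "F \<in> {F. F \<subseteq> A \<and> finite F}"
    then have "\<forall>x\<in>F. sum_list x < Suc (Max (sum_list ` F))"
      by (auto simp: less_Suc_eq_le)
    then show "(\<Sum>x\<in>F. norm (w x)) \<le> b / (1 - r)"
      using F bound by blast
  qed
  then have "w summable_on A"
    by (simp add: summable_on_iff_abs_summable_on_complex)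
  then obtain S where S: "(w has_sum S) A"
    using has_sum_infsum by blast
  have "((\<lambda>x. w (g x)) has_sum (q ^ d * S)) A"
    using has_sum_cmult_right[OF S, of "q ^ d"]
    by (rule has_sum_cong[THEN iffD1, rotated]) (simp add: w_def wt power_add)
  then have "(w has_sum (q ^ d * S)) (g ` A)"
    using has_sum_reindex[OF inj, of w] by (simp add: o_def)
  then have "(w has_sum (s + q ^ d * S)) A"
    using has_sum_Un_disjoint[OF B[folded w_def] _ disj] A by simp
  then have "S = s + q ^ d * S" using S has_sum_unique by blast
  moreover have "1 - q ^ d \<noteq> 0"
    using r by (auto simp: r_def norm_power[symmetric])
  ultimately have "S = s / (1 - q ^ d)" by (simp add: field_simps)
  then show ?thesis using S by (simp add: w_def)
qed

section \<open>Generating functions of staircases in a strip\<close>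

text \<open>The numerator of \<open>F m k\<close> over the common denominator \<open>(1 - q) (1 - q ^ 2) \<cdots> (1 - q ^ m)\<close>.\<close>

fun stair_num :: "'a::comm_ring_1 \<Rightarrow> nat \<Rightarrow> nat \<Rightarrow> 'a" where
  "stair_num q m 0 = 1"
| "stair_num q 0 (Suc k) = 0"
| "stair_num q (Suc m) (Suc k) =
     (if m < k then 0
      else (1 - q ^ Suc m) * stair_num q m (Suc k) + q ^ Suc m * stair_num q (Suc m) k)"

text \<open>The generating function \<open>F m k\<close> of the partitions with at most \<open>m\<close> rows (equivalently, at
most \<open>m\<close> columns) that contain a staircase of size \<open>k\<close>.\<close>

definition stair_gf :: "complex \<Rightarrow> nat \<Rightarrow> nat \<Rightarrow> complex" where
  "stair_gf q m k = stair_num q m k / (\<Prod>j<m. 1 - q ^ Suc j)"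

text \<open>The recursion is proved once for families \<open>A m k\<close> of lists, with \<open>f m\<close> the embedding of the smaller
strip and \<open>g m\<close> the operation that adds \<open>m + 1\<close> squares; it applies to both kinds of strips. For
\<open>k = 0\<close> the truncated \<open>k - 1\<close> makes the decomposition refer to \<open>A (Suc m) 0\<close> itself, which is where the
denominator arises.\<close>

lemma stair_gf_has_sum:
  fixes q :: complex and A :: "nat \<Rightarrow> nat \<Rightarrow> nat list set"
  assumes q: "norm q < 1"
    and A00: "A 0 0 = {[]}" and empty: "\<And>m k. m < k \<Longrightarrow> A m k = {}"
    and A: "\<And>m k. k \<le> Suc m \<Longrightarrow> A (Suc m) k = f m ` A m k \<union> g m ` A (Suc m) (k - 1)"
    and disj: "\<And>m k. f m ` A m k \<inter> g m ` A (Suc m) (k - 1) = {}"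
    and inj: "\<And>m. inj (f m)" "\<And>m. inj (g m)"
    and f: "\<And>m x. sum_list (f m x) = sum_list x"
    and g: "\<And>m k x. x \<in> A (Suc m) k \<Longrightarrow> sum_list (g m x) = Suc m + sum_list x"
  shows "((\<lambda>x. q ^ sum_list x) has_sum stair_gf q m k) (A m k)"
proof (induction m arbitrary: k)
  case 0
  show ?case
  proof (cases k)
    case 0
    then show ?thesis using has_sum_finite[of "{[] :: nat list}" "\<lambda>x. q ^ sum_list x"]
      by (simp add: stair_gf_def A00)
  qed (simp add: stair_gf_def empty)
next
  case (Suc m)
  have nz: "1 - q ^ Suc j \<noteq> 0" for j
    using q power_eq_1_iff[of q "Suc j"] by force
  then have prod_nz: "(\<Prod>j<m. 1 - q ^ Suc j) \<noteq> 0" for m by simp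
  have image_f: "((\<lambda>x. q ^ sum_list x) has_sum stair_gf q m k) (f m ` A m k)" for k
    using Suc.IH[of k] has_sum_reindex[of "f m" "A m k" "\<lambda>x. q ^ sum_list x"]
      inj_on_subset[OF inj(1)[of m] subset_UNIV] by (simp add: o_def f)
  show ?case
  proof (induction k)
    case 0
    have "((\<lambda>x. q ^ sum_list x) has_sum (stair_gf q m 0 / (1 - q ^ Suc m))) (A (Suc m) 0)"
      using A[of 0 m] disj[of m 0] inj(2)[of m] image_f[of 0] g q
      by (intro has_sum_self_similar[where g = "g m" and B = "f m ` A m 0"])
        (auto intro: inj_on_subset)
    then show ?case by (simp add: stair_gf_def)
  next
    case (Suc k)
    show ?case
    proof (cases "m < k")
      case True
      then show ?thesis by (simp add: stair_gf_def empty)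
    next
      case False
      have "((\<lambda>x. q ^ sum_list (g m x)) has_sum (q ^ Suc m * stair_gf q (Suc m) k)) (A (Suc m) k)"
        using has_sum_cmult_right[OF Suc.IH, of "q ^ Suc m"]
        by (rule has_sum_cong[THEN iffD1, rotated]) (simp add: g power_add)
      then have "((\<lambda>x. q ^ sum_list x) has_sum (q ^ Suc m * stair_gf q (Suc m) k)) (g m ` A (Suc m) k)"
        using has_sum_reindex[of "g m" "A (Suc m) k" "\<lambda>x. q ^ sum_list x"]
          inj_on_subset[OF inj(2)[of m] subset_UNIV] by (simp add: o_def)
      then have "((\<lambda>x. q ^ sum_list x) has_sum
          (stair_gf q m (Suc k) + q ^ Suc m * stair_gf q (Suc m) k)) (A (Suc m) (Suc k))"
        using has_sum_Un_disjoint[OF image_f] A[of "Suc k" m] False disj[of m "Suc k"] by simp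
      moreover have "stair_gf q m (Suc k) + q ^ Suc m * stair_gf q (Suc m) k = stair_gf q (Suc m) (Suc k)"
        using nz[of m] prod_nz[of m] unfolding stair_gf_def stair_num.simps if_not_P[OF False] prod.lessThan_Suc
        by (simp add: divide_simps del: power_Suc)
      ultimately show ?thesis by simp
    qed
  qed
qed

lemma staircase_map_Suc: "k \<le> length \<mu> \<Longrightarrow> staircase k (map Suc \<mu>) \<longleftrightarrow> staircase (k - 1) \<mu>"
  by (cases k) (auto simp: staircase_def All_less_Suc)

lemma staircase_snoc_0: "staircase k (\<mu> @ [0]) \<longleftrightarrow> staircase k \<mu>"
  unfolding staircase_def by (auto 0 3 simp: nth_append less_Suc_eq)

lemma staircase_Cons: "k \<le> a \<Longrightarrow> staircase k (a # \<nu>) \<longleftrightarrow> staircase (k - 1) \<nu>"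
  by (cases k) (auto simp: staircase_def All_less_Suc2)

lemma staircase_0_nil: "staircase k [] \<longleftrightarrow> k = 0"
  by (auto simp: staircase_def)

text \<open>In a strip of \<open>m\<close> rows either the last row is empty, or one square can be removed
from every row.\<close>

lemma short_stairs_has_sum:
  fixes q :: complex
  assumes "norm q < 1"
  shows "((\<lambda>\<mu>. q ^ sum_list \<mu>) has_sum stair_gf q m k) (short_stairs m k)"
proof (rule stair_gf_has_sum[where f = "\<lambda>_ \<mu>. \<mu> @ [0]" and g = "\<lambda>_. map Suc", OF assms])
  show "short_stairs 0 0 = {[]}"
    by (auto simp: short_stairs_def staircase_0_nil)
  show "short_stairs m k = {}" if "m < k" for m k
    using that staircase_length by (fastforce simp: short_stairs_def)
  show "(\<lambda>\<mu>. \<mu> @ [0]) ` short_stairs m k \<inter> map Suc ` short_stairs (Suc m) (k - 1) = {}" for m k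
  proof -
    have "\<mu> @ [0] \<noteq> map Suc \<nu>" for \<mu> \<nu>
    proof
      assume "\<mu> @ [0] = map Suc \<nu>"
      then have "0 \<in> set (map Suc \<nu>)" by (metis in_set_conv_decomp)
      then show False by simp
    qed
    then show ?thesis by blast
  qed
  show "sum_list (map Suc \<mu>) = Suc m + sum_list \<mu>" if "\<mu> \<in> short_stairs (Suc m) k" for m k \<mu>
    using that sum_list_Suc[of "\<lambda>x. x" \<mu>] by (simp add: short_stairs_def)
  show "short_stairs (Suc m) k =
      (\<lambda>\<mu>. \<mu> @ [0]) ` short_stairs m k \<union> map Suc ` short_stairs (Suc m) (k - 1)" if "k \<le> Suc m" for m k
  proof (intro equalityI subsetI)
    fix \<mu> assume \<mu>: "\<mu> \<in> short_stairs (Suc m) k"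
    then have "\<mu> \<noteq> []" by (auto simp: short_stairs_def)
    then obtain \<nu> a where \<nu>: "\<mu> = \<nu> @ [a]" by (metis rev_exhaust)
    show "\<mu> \<in> (\<lambda>\<mu>. \<mu> @ [0]) ` short_stairs m k \<union> map Suc ` short_stairs (Suc m) (k - 1)"
    proof (cases "a = 0")
      case True
      then show ?thesis
        using \<mu> by (auto simp: \<nu> short_stairs_def sorted_wrt_append staircase_snoc_0)
    next
      case False
      then have "\<forall>x\<in>set \<mu>. 0 < x"
        using \<mu> by (fastforce simp: \<nu> short_stairs_def sorted_wrt_append)
      then have "\<mu> = map Suc (map (\<lambda>x. x - 1) \<mu>)"
        by (auto intro!: map_idI[symmetric])
      then obtain \<rho> where "\<mu> = map Suc \<rho>" by blast
      then have "\<rho> \<in> short_stairs (Suc m) (k - 1)"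
        using \<mu> staircase_length[of k \<mu>]
        by (auto simp: short_stairs_def sorted_wrt_map staircase_map_Suc)
      then show ?thesis using \<open>\<mu> = map Suc \<rho>\<close> by blast
    qed
  next
    fix \<mu> assume "\<mu> \<in> (\<lambda>\<mu>. \<mu> @ [0]) ` short_stairs m k \<union> map Suc ` short_stairs (Suc m) (k - 1)"
    then show "\<mu> \<in> short_stairs (Suc m) k"
    proof
      assume "\<mu> \<in> (\<lambda>\<mu>. \<mu> @ [0]) ` short_stairs m k"
      then show ?thesis
        by (auto simp: short_stairs_def sorted_wrt_append staircase_snoc_0)
    next
      assume "\<mu> \<in> map Suc ` short_stairs (Suc m) (k - 1)"
      then obtain \<rho> where \<rho>: "\<mu> = map Suc \<rho>" "\<rho> \<in> short_stairs (Suc m) (k - 1)" by blast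
      then have "k \<le> length \<rho>"
        using that by (simp add: short_stairs_def)
      then show ?thesis
        using \<rho> by (auto simp: short_stairs_def sorted_wrt_map staircase_map_Suc)
    qed
  qed
qed (auto simp: inj_def)

text \<open>In a strip of \<open>m\<close> columns either all rows are shorter than \<open>m\<close>, or the first row is full and can be
removed.\<close>

lemma narrow_stairs_has_sum:
  fixes q :: complex
  assumes "norm q < 1"
  shows "((\<lambda>\<nu>. q ^ sum_list \<nu>) has_sum stair_gf q m k) (narrow_stairs m k)"
proof (rule stair_gf_has_sum[where f = "\<lambda>_ \<nu>. \<nu>" and g = "\<lambda>m. (#) (Suc m)", OF assms])
  have nil: "\<nu> = []" if "\<nu> \<in> narrow_stairs 0 k" for \<nu> k
    using that by (cases \<nu>) (auto simp: narrow_stairs_def)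
  show "narrow_stairs 0 0 = {[]}"
    using nil by (auto simp: narrow_stairs_def staircase_0_nil)
  have le: "k \<le> m" if "\<nu> \<in> narrow_stairs m k" for \<nu> m k
    using that by (cases k; cases \<nu>) (force simp: narrow_stairs_def staircase_def)+
  show "narrow_stairs m k = {}" if "m < k" for m k
    using that le by (meson equals0I not_le)
  show "(\<lambda>\<nu>. \<nu>) ` narrow_stairs m k \<inter> (#) (Suc m) ` narrow_stairs (Suc m) (k - 1) = {}" for m k
    by (auto simp: narrow_stairs_def)
  show "narrow_stairs (Suc m) k =
      (\<lambda>\<nu>. \<nu>) ` narrow_stairs m k \<union> (#) (Suc m) ` narrow_stairs (Suc m) (k - 1)" if "k \<le> Suc m" for m k
  proof (intro equalityI subsetI)
    fix \<nu> assume \<nu>: "\<nu> \<in> narrow_stairs (Suc m) k"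
    show "\<nu> \<in> (\<lambda>\<nu>. \<nu>) ` narrow_stairs m k \<union> (#) (Suc m) ` narrow_stairs (Suc m) (k - 1)"
    proof (cases "\<exists>\<rho>. \<nu> = Suc m # \<rho>")
      case True
      then obtain \<rho> where \<rho>: "\<nu> = Suc m # \<rho>" by blast
      then show ?thesis
        using \<nu> that by (auto simp: \<rho> narrow_stairs_def staircase_Cons)
    next
      case False
      then have "x \<le> m" if "x \<in> set \<nu>" for x
        using that \<nu> by (cases \<nu>) (fastforce simp: narrow_stairs_def le_Suc_eq)+
      then show ?thesis using \<nu> by (auto simp: narrow_stairs_def)
    qed
  next
    fix \<nu> assume "\<nu> \<in> (\<lambda>\<nu>. \<nu>) ` narrow_stairs m k \<union> (#) (Suc m) ` narrow_stairs (Suc m) (k - 1)"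
    then show "\<nu> \<in> narrow_stairs (Suc m) k"
    proof
      assume "\<nu> \<in> (#) (Suc m) ` narrow_stairs (Suc m) (k - 1)"
      then obtain \<rho> where \<rho>: "\<nu> = Suc m # \<rho>" "\<rho> \<in> narrow_stairs (Suc m) (k - 1)" by blast
      then show ?thesis
        using that by (auto simp: narrow_stairs_def staircase_Cons)
    qed (auto simp: narrow_stairs_def)
  qed
qed (auto simp: inj_def)

section \<open>The generating function for a given max-rook number\<close>

lemma max_rook_gf:
  fixes q :: complex
  assumes q: "norm q < 1"
  shows "((\<lambda>\<pi>. q ^ sum_list \<pi>) has_sum
      (\<Sum>i\<le>k. q ^ (i * (Suc k - i)) * (stair_gf q i i * stair_gf q (k - i) (k - i))))
    {\<pi>. sorted_wrt (\<ge>) \<pi> \<and> (\<forall>x\<in>set \<pi>. 0 < x) \<and> max_rook \<pi> = k}" (is "(_ has_sum ?s) ?P")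
proof -
  define T where "T = (SIGMA i:{..k}. short_stairs i i \<times> narrow_stairs (k - i) (k - i))"
  define h where "h = (\<lambda>(i, \<mu>, \<nu>). q ^ (i * (Suc k - i)) * (q ^ sum_list \<mu> * q ^ sum_list \<nu>))"
  have P: "?P = {\<pi>. sorted_wrt (\<ge>) \<pi> \<and> (\<forall>x\<in>set \<pi>. 0 < x) \<and> staircase k \<pi> \<and> \<not> staircase (Suc k) \<pi>}"
    using max_rook_eq_iff by blast
  have part: "((\<lambda>(\<mu>, \<nu>). h (i, \<mu>, \<nu>)) has_sum
      (q ^ (i * (Suc k - i)) * (stair_gf q i i * stair_gf q (k - i) (k - i))))
      (short_stairs i i \<times> narrow_stairs (k - i) (k - i))" for i
    using has_sum_cmult_right[OF has_sum_product_complex[OF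
        short_stairs_has_sum[OF q] narrow_stairs_has_sum[OF q]], of "q ^ (i * (Suc k - i))"]
    by (simp add: h_def case_prod_unfold)
  have "h abs_summable_on T"
    unfolding T_def
  proof (subst abs_summable_on_Sigma_iff, rule conjI)
    have "(\<lambda>y. h (i, y)) abs_summable_on short_stairs i i \<times> narrow_stairs (k - i) (k - i)" for i
      using has_sum_imp_summable[OF part[of i]]
      unfolding summable_on_iff_abs_summable_on_complex by (simp add: case_prod_unfold)
    then show "\<forall>i\<in>{..k}. (\<lambda>y. h (i, y)) abs_summable_on
        short_stairs i i \<times> narrow_stairs (k - i) (k - i)"
      by blast
  qed simp
  then have summable: "h summable_on T"
    by (simp add: summable_on_iff_abs_summable_on_complex)
  have "(h has_sum ?s) T"
    unfolding T_def
  proof (rule has_sum_SigmaI[where g = "\<lambda>i. q ^ (i * (Suc k - i)) * (stair_gf q i i * stair_gf q (k - i) (k - i))"])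
    show "((\<lambda>y. h (i, y)) has_sum
        (q ^ (i * (Suc k - i)) * (stair_gf q i i * stair_gf q (k - i) (k - i))))
      (short_stairs i i \<times> narrow_stairs (k - i) (k - i))" for i
      using part[of i] by (simp add: case_prod_unfold)
  qed (use summable in \<open>simp_all add: T_def\<close>)
  also have "(h has_sum ?s) T \<longleftrightarrow> ((\<lambda>\<pi>. q ^ sum_list \<pi>) has_sum ?s) ?P"
  proof (rule has_sum_reindex_bij_witness[where
        j = "\<lambda>(i, \<mu>, \<nu>). map ((+) (Suc k - i)) \<mu> @ \<nu>" and
        i = "\<lambda>\<pi>. let i = corner k \<pi> in (i, map (\<lambda>x. x - (Suc k - i)) (take i \<pi>), drop i \<pi>)"])
    fix t assume "t \<in> T"
    then obtain i \<mu> \<nu> where t: "t = (i, \<mu>, \<nu>)" "i \<le> k"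
      "\<mu> \<in> short_stairs i i" "\<nu> \<in> narrow_stairs (k - i) (k - i)"
      by (auto simp: T_def)
    note glue = glue_stairs[OF t(2-4)]
    have len: "length \<mu> = i" using t(3) by (simp add: short_stairs_def)
    show "(let i = corner k (case t of (i, \<mu>, \<nu>) \<Rightarrow> map ((+) (Suc k - i)) \<mu> @ \<nu>) in
        (i, map (\<lambda>x. x - (Suc k - i)) (take i (case t of (i, \<mu>, \<nu>) \<Rightarrow> map ((+) (Suc k - i)) \<mu> @ \<nu>)),
          drop i (case t of (i, \<mu>, \<nu>) \<Rightarrow> map ((+) (Suc k - i)) \<mu> @ \<nu>))) = t"
      unfolding t(1) prod.case glue(5) by (simp add: len Let_def o_def)
    show "(case t of (i, \<mu>, \<nu>) \<Rightarrow> map ((+) (Suc k - i)) \<mu> @ \<nu>) \<in> ?P"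
      unfolding P t(1) prod.case using glue by simp
    have "sum_list (map ((+) (Suc k - i)) \<mu>) = i * (Suc k - i) + sum_list \<mu>"
      using sum_list_addf[of "\<lambda>_. Suc k - i" "\<lambda>x. x" \<mu>] by (simp add: len sum_list_triv)
    then show "q ^ sum_list (case t of (i, \<mu>, \<nu>) \<Rightarrow> map ((+) (Suc k - i)) \<mu> @ \<nu>) = h t"
      by (simp add: t(1) h_def power_add)
  next
    fix \<pi> assume "\<pi> \<in> ?P"
    then have \<pi>: "sorted_wrt (\<ge>) \<pi>" "\<forall>x\<in>set \<pi>. 0 < x" "staircase k \<pi>" "\<not> staircase (Suc k) \<pi>"
      unfolding P by auto
    note cut = cut_stairs[OF \<pi>]
    show "(case let i = corner k \<pi> in (i, map (\<lambda>x. x - (Suc k - i)) (take i \<pi>), drop i \<pi>)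
        of (i, \<mu>, \<nu>) \<Rightarrow> map ((+) (Suc k - i)) \<mu> @ \<nu>) = \<pi>"
      unfolding Let_def prod.case cut(3) by simp
    show "(let i = corner k \<pi> in (i, map (\<lambda>x. x - (Suc k - i)) (take i \<pi>), drop i \<pi>)) \<in> T"
      unfolding T_def Let_def using cut(1,2) corner_le[OF \<pi>(4)] by simp
  qed simp
  finally show ?thesis .
qed

text \<open>Collecting the partitions by size turns the sum over partitions into a power series. Its
constant term vanishes, because the empty partition has max-rook number \<open>0 \<noteq> k\<close>.\<close>

lemma R_sums:
  fixes q s :: complex
  assumes "0 < k" and
    s: "((\<lambda>\<pi>. q ^ sum_list \<pi>) has_sum s)
      {\<pi>. sorted_wrt (\<ge>) \<pi> \<and> (\<forall>x\<in>set \<pi>. 0 < x) \<and> max_rook \<pi> = k}" (is "(_ has_sum _) ?P")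
  shows "(\<lambda>n. of_nat (R k (Suc n)) * q ^ Suc n) sums s"
proof -
  define B where "B = (\<lambda>n. {\<pi> \<in> partitions n. max_rook \<pi> = k})"
  have "((\<lambda>(n, \<pi>). q ^ sum_list \<pi>) has_sum s) (Sigma UNIV B)"
    by (rule has_sum_reindex_bij_witness[where j = snd and i = "\<lambda>\<pi>. (sum_list \<pi>, \<pi>)",
          THEN iffD2, OF _ _ _ _ _ _ s]) (auto simp: B_def partitions_def)
  then have "((\<lambda>n. of_nat (R k n) * q ^ n) has_sum s) UNIV"
  proof (rule has_sum_SigmaD)
    fix n
    have "(\<Sum>\<pi>\<in>B n. q ^ sum_list \<pi>) = of_nat (R k n) * q ^ n"
      by (simp add: B_def R_def partitions_def)
    moreover have "finite (B n)" using finite_partitions[of n] by (simp add: B_def)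
    ultimately show "((\<lambda>\<pi>. case (n, \<pi>) of (n, \<pi>) \<Rightarrow> q ^ sum_list \<pi>) has_sum of_nat (R k n) * q ^ n) (B n)"
      by (auto intro: has_sum_finiteI)
  qed
  then have sums: "(\<lambda>n. of_nat (R k n) * q ^ n) sums s" by (rule has_sum_imp_sums)
  have "partitions 0 = {[]}"
    by (auto simp: partitions_def) (metis all_not_in_conv less_irrefl set_empty)
  moreover have "max_rook [] \<noteq> k"
    using \<open>0 < k\<close> by (simp add: max_rook_eq_iff staircase_0_nil)
  ultimately have "R k 0 = 0" by (simp add: R_def)
  then show ?thesis using sums sums_Suc_iff[of "\<lambda>n. of_nat (R k n) * q ^ n" s] by simp
qed

section \<open>Evaluation for max-rook number five\<close>

lemma stair_num_eq_0: "m < k \<Longrightarrow> stair_num q m k = 0"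
  by (cases m; cases k) auto

text \<open>The recursion without successors on the left, so that it rewrites with numerals.\<close>

lemma stair_num_rec:
  "0 < m \<Longrightarrow> 0 < k \<Longrightarrow> k \<le> m \<Longrightarrow>
    stair_num q m k = (1 - q ^ m) * stair_num q (m - 1) k + q ^ m * stair_num q m (k - 1)"
  by (cases m; cases k) auto

lemma stair_num_diagonal:
  fixes q :: complex
  shows "stair_num q 0 0 = 1"
    and "stair_num q 1 1 = q"
    and "stair_num q 2 2 = q ^ 3 + q ^ 4 - q ^ 5"
    and "stair_num q 3 3 = q ^ 6 + 2 * q ^ 7 - q ^ 9 - 2 * q ^ 10 + q ^ 12"
    and "stair_num q 4 4 = q ^ 10 + 3 * q ^ 11 + 2 * q ^ 12 - 3 * q ^ 14 - 5 * q ^ 15 - q ^ 16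
      + 3 * q ^ 18 + 2 * q ^ 19 - q ^ 22"
    and "stair_num q 5 5 = q ^ 15 + 4 * q ^ 16 + 5 * q ^ 17 + 3 * q ^ 18 - q ^ 19 - 8 * q ^ 20
      - 9 * q ^ 21 - 8 * q ^ 22 - 2 * q ^ 23 + 5 * q ^ 24 + 9 * q ^ 25 + 7 * q ^ 26 + 3 * q ^ 27
      - q ^ 28 - 4 * q ^ 29 - 2 * q ^ 30 - 2 * q ^ 31 + q ^ 35"
proof -
  note rec = stair_num_rec[of "numeral m" "numeral k" for m k]
    stair_num_rec[of "numeral m" "Suc 0" for m]
  show "stair_num q 0 0 = 1" "stair_num q 1 1 = q" by simp_all
  show "stair_num q 2 2 = q ^ 3 + q ^ 4 - q ^ 5"
    by (simp add: rec stair_num_eq_0) algebra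
  show "stair_num q 3 3 = q ^ 6 + 2 * q ^ 7 - q ^ 9 - 2 * q ^ 10 + q ^ 12"
    by (simp add: rec stair_num_eq_0) algebra
  show "stair_num q 4 4 = q ^ 10 + 3 * q ^ 11 + 2 * q ^ 12 - 3 * q ^ 14 - 5 * q ^ 15 - q ^ 16
      + 3 * q ^ 18 + 2 * q ^ 19 - q ^ 22"
    by (simp add: rec stair_num_eq_0) algebra
  show "stair_num q 5 5 = q ^ 15 + 4 * q ^ 16 + 5 * q ^ 17 + 3 * q ^ 18 - q ^ 19 - 8 * q ^ 20
      - 9 * q ^ 21 - 8 * q ^ 22 - 2 * q ^ 23 + 5 * q ^ 24 + 9 * q ^ 25 + 7 * q ^ 26 + 3 * q ^ 27
      - q ^ 28 - 4 * q ^ 29 - 2 * q ^ 30 - 2 * q ^ 31 + q ^ 35"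
    by (simp add: rec stair_num_eq_0) algebra
qed

theorem theorem3p5:
  fixes q :: complex
  assumes "norm q < 1"
  shows "(\<lambda>n. of_nat (R 5 (Suc n)) * q ^ Suc n) sums
    (q ^ 15 *
      (1 + 4 * q + 6 * q ^ 2 + 8 * q ^ 3 + 8 * q ^ 4 + 4 * q ^ 5 + 4 * q ^ 6 - 5 * q ^ 7
       - 5 * q ^ 8 - 10 * q ^ 9 - 7 * q ^ 10 - 5 * q ^ 11 + 4 * q ^ 13 + 6 * q ^ 14
       + 7 * q ^ 15 + 2 * q ^ 17 - 4 * q ^ 18 - q ^ 19 - q ^ 20 - q ^ 21 + q ^ 22
       - q ^ 23 + q ^ 24) /
     ((1 - q) ^ 2 * (1 - q ^ 3) * (1 - q ^ 4) * (1 - q ^ 5)))"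
proof -
  have nz: "1 - q ^ j \<noteq> 0" if "0 < j" for j
    using assms that power_eq_1_iff[of q j] by force
  have e: "1 - q \<noteq> 0" "1 - q ^ 2 \<noteq> 0" "1 - q ^ 3 \<noteq> 0" "1 - q ^ 4 \<noteq> 0" "1 - q ^ 5 \<noteq> 0"
    using nz[of 1] nz[of 2] nz[of 3] nz[of 4] nz[of 5] by simp_all
  define D where "D = (1 - q) * (1 - q ^ 2) * (1 - q ^ 3) * (1 - q ^ 4) * (1 - q ^ 5)"
  \<comment> \<open>The Gaussian binomial coefficients of 5 over 1 and of 5 over 2, which bring the products
    \<open>S\<^sub>i S\<^sub>5\<^sub>-\<^sub>i\<close> to the common denominator \<open>D\<close>.\<close>
  define b1 where "b1 = 1 + q + q ^ 2 + q ^ 3 + q ^ 4"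
  define b2 where "b2 = (1 + q ^ 2) * b1"
  have gf: "stair_gf q i i * stair_gf q (5 - i) (5 - i) = stair_num q i i * stair_num q (5 - i) (5 - i) * b / D"
    if "(\<Prod>j<i. 1 - q ^ Suc j) * (\<Prod>j<5 - i. 1 - q ^ Suc j) * b = D" for i b
  proof -
    have "D \<noteq> 0" using e by (simp add: D_def)
    then show ?thesis using that by (auto simp: stair_gf_def divide_simps)
  qed
  have t0: "stair_gf q 0 0 * stair_gf q 5 5 = stair_num q 0 0 * stair_num q 5 5 / D"
    using gf[of 0 1] by (simp add: D_def eval_nat_numeral)
  have t1: "stair_gf q 1 1 * stair_gf q 4 4 = stair_num q 1 1 * stair_num q 4 4 * b1 / D"
    using gf[of 1 b1] by (simp add: D_def b1_def eval_nat_numeral) algebra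
  have t2: "stair_gf q 2 2 * stair_gf q 3 3 = stair_num q 2 2 * stair_num q 3 3 * b2 / D"
    using gf[of 2 b2] by (simp add: D_def b2_def b1_def eval_nat_numeral) algebra
  \<comment> \<open>The terms for \<open>i\<close> and \<open>5 - i\<close> contain the same product.\<close>
  have "(\<Sum>i\<le>5. q ^ (i * (Suc 5 - i)) * (stair_gf q i i * stair_gf q (5 - i) (5 - i))) =
      (1 + q ^ 5) * (stair_gf q 0 0 * stair_gf q 5 5)
      + (q ^ 5 + q ^ 8) * (stair_gf q 1 1 * stair_gf q 4 4)
      + (q ^ 8 + q ^ 9) * (stair_gf q 2 2 * stair_gf q 3 3)"
    by (simp add: atMost_nat_numeral algebra_simps)
  also have "\<dots> = ((1 + q ^ 5) * (stair_num q 0 0 * stair_num q 5 5)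
      + (q ^ 5 + q ^ 8) * (stair_num q 1 1 * stair_num q 4 4 * b1)
      + (q ^ 8 + q ^ 9) * (stair_num q 2 2 * stair_num q 3 3 * b2)) / D"
    unfolding t0 t1 t2 by (simp only: add_divide_distrib times_divide_eq_right)
  also have "\<dots> = q ^ 15 *
      (1 + 4 * q + 6 * q ^ 2 + 8 * q ^ 3 + 8 * q ^ 4 + 4 * q ^ 5 + 4 * q ^ 6 - 5 * q ^ 7
       - 5 * q ^ 8 - 10 * q ^ 9 - 7 * q ^ 10 - 5 * q ^ 11 + 4 * q ^ 13 + 6 * q ^ 14
       + 7 * q ^ 15 + 2 * q ^ 17 - 4 * q ^ 18 - q ^ 19 - q ^ 20 - q ^ 21 + q ^ 22
       - q ^ 23 + q ^ 24) * (1 + q) / D"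
    unfolding stair_num_diagonal b2_def b1_def by (rule arg_cong[of _ _ "\<lambda>x. x / D"]) algebra
  \<comment> \<open>The factor \<open>1 + q\<close> of \<open>1 - q ^ 2\<close> in \<open>D\<close> also divides the numerator.\<close>
  also have "D = (1 - q) ^ 2 * (1 - q ^ 3) * (1 - q ^ 4) * (1 - q ^ 5) * (1 + q)"
    unfolding D_def by algebra
  also have "q ^ 15 *
      (1 + 4 * q + 6 * q ^ 2 + 8 * q ^ 3 + 8 * q ^ 4 + 4 * q ^ 5 + 4 * q ^ 6 - 5 * q ^ 7
       - 5 * q ^ 8 - 10 * q ^ 9 - 7 * q ^ 10 - 5 * q ^ 11 + 4 * q ^ 13 + 6 * q ^ 14
       + 7 * q ^ 15 + 2 * q ^ 17 - 4 * q ^ 18 - q ^ 19 - q ^ 20 - q ^ 21 + q ^ 22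
       - q ^ 23 + q ^ 24) * (1 + q) / \<dots> = q ^ 15 *
      (1 + 4 * q + 6 * q ^ 2 + 8 * q ^ 3 + 8 * q ^ 4 + 4 * q ^ 5 + 4 * q ^ 6 - 5 * q ^ 7
       - 5 * q ^ 8 - 10 * q ^ 9 - 7 * q ^ 10 - 5 * q ^ 11 + 4 * q ^ 13 + 6 * q ^ 14
       + 7 * q ^ 15 + 2 * q ^ 17 - 4 * q ^ 18 - q ^ 19 - q ^ 20 - q ^ 21 + q ^ 22
       - q ^ 23 + q ^ 24) / ((1 - q) ^ 2 * (1 - q ^ 3) * (1 - q ^ 4) * (1 - q ^ 5))"
  proof (rule mult_divide_mult_cancel_right)
    have "(1 - q) * (1 + q) = 1 - q ^ 2" by algebra
    then show "1 + q \<noteq> 0" using e(2) by auto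
  qed
  finally show ?thesis
    using R_sums[OF _ max_rook_gf[OF assms, of 5]] by simp
qed

end
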